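(* Let $n\in\mathbb{N}$, let $S_1,\ldots,S_n$ be finite semigroups, let $S=\prod_{i=1}^n S_i$ be their direct product, and let $\mathit{NC}=\{i\in\{1,\ldots,n\}: S_i\text{ is not commutative}\}$. Suppose that $\mathit{NC}\neq\emptyset$. (1) Suppose that $\mathit{NC}=\{i\}$. Then $\mathcal{G}(S)$ is connected if and only if $\mathcal{G}(S_i)$ is connected, in which case $\mathrm{diam}(\mathcal{G}(S))=\mathrm{diam}(\mathcal{G}(S_i))$. (2) Suppose that $|\mathit{NC}|\geqslant 2$. Then $\mathcal{G}(S)$ is connected if and only if for all $i\in\mathit{NC}$ we have $Z(S_i)\neq\emptyset$ or $\mathcal{G}(S_i)$ is connected. In this case (that is, when $\mathcal{G}(S)$ is connected) we have: (a) If $Z(S_i)\neq\emptyset$ for all $i\in\mathit{NC}$, then $\mathrm{diam}(\mathcal{G}(S))\in\{2,3\}$. Moreover, $\mathrm{diam}(\mathcal{G}(S))=2$ if and only if there exists $j\in\mathit{NC}$ such that $\mathrm{diam}(\mathcal{G}(S_j))=2$. (b) If there exists $j\in\mathit{NC}$ such that $Z(S_j)=\emptyset$, then $\mathrm{diam}(\mathcal{G}(S))=\max\{\mathrm{diam}(\mathcal{G}(S_i)) : i\in\mathit{NC}\text{ and }Z(S_i)=\emptyset\}$.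
   Context: Semigroups are non-empty. The direct product $\prod_{i=1}^n S_i$ is the cartesian product with componentwise multiplication. The center of a semigroup $T$ is $Z(T)=\{x\in T: xy=yx \text{ for all } y\in T\}$ (possibly empty). For a finite non-commutative semigroup $T$, the commuting graph $\mathcal{G}(T)$ is the simple graph with vertex set $T\setminus Z(T)$ in which two distinct vertices $x,y$ are adjacent if and only if $xy=yx$. The distance between two vertices is the length (number of edges) of a shortest path between them, and is $\infty$ if there is no such path; $\mathrm{diam}(G)$ is the maximum distance between vertices of $G$. Thus $\mathrm{diam}(G)=\infty$ when the finite graph $G$ is not connected; in (2)(a) some of the $\mathcal{G}(S_i)$ with $i\in\mathit{NC}$ may be disconnected. *)

theory Defs
  imports
    "HOL-Algebra.Product_Groups"
    "HOL-Library.Extended_Nat"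
    "Graph_Theory.Arc_Walk"
    "Graph_Theory.Digraph_Component"
begin

text \<open>
  A semigroup is represented by the carrier and multiplication of a record of type
  \<^typ>\<open>('a, 'b) monoid_scheme\<close>. The field \<^const>\<open>one\<close> is arbitrary: nothing below depends on it,
  and it need not lie in the carrier. With this reading \<^const>\<open>product_group\<close>, which multiplies
  componentwise on the extensional functions, is also the direct product of semigroups.
\<close>

locale nonempty_semigroup =
  fixes T (structure)
  assumes nonempty: "carrier T \<noteq> {}"
    and m_closed: "\<lbrakk>x \<in> carrier T; y \<in> carrier T\<rbrakk> \<Longrightarrow> x \<otimes> y \<in> carrier T"
    and m_assoc: "\<lbrakk>x \<in> carrier T; y \<in> carrier T; z \<in> carrier T\<rbrakk>
      \<Longrightarrow> (x \<otimes> y) \<otimes> z = x \<otimes> (y \<otimes> z)"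

definition commutative :: "('a, 'b) monoid_scheme \<Rightarrow> bool" where
  "commutative T \<longleftrightarrow>
     (\<forall>x\<in>carrier T. \<forall>y\<in>carrier T. x \<otimes>\<^bsub>T\<^esub> y = y \<otimes>\<^bsub>T\<^esub> x)"

definition center :: "('a, 'b) monoid_scheme \<Rightarrow> 'a set" where
  "center T = {x \<in> carrier T. \<forall>y\<in>carrier T. x \<otimes>\<^bsub>T\<^esub> y = y \<otimes>\<^bsub>T\<^esub> x}"

text \<open>
  As in \<^theory>\<open>Graph_Theory.Digraph\<close>, a simple graph is a symmetric loopfree digraph without
  multiple arcs: each edge is represented by the two ordered pairs of its ends.
\<close>

definition commuting_graph :: "('a, 'b) monoid_scheme \<Rightarrow> ('a, 'a \<times> 'a) pre_digraph" where
  "commuting_graph T =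
     \<lparr>verts = carrier T - center T,
      arcs = {(x, y). x \<in> carrier T - center T \<and> y \<in> carrier T - center T \<and>
                      x \<noteq> y \<and> x \<otimes>\<^bsub>T\<^esub> y = y \<otimes>\<^bsub>T\<^esub> x},
      tail = fst, head = snd\<rparr>"

lemma graph_commuting_graph:
  assumes "finite (carrier T)"
  shows "graph (commuting_graph T)"
proof -
  have "arcs (commuting_graph T) \<subseteq> carrier T \<times> carrier T"
    by (auto simp: commuting_graph_def)
  then have "finite (arcs (commuting_graph T))"
    using assms by (meson finite_SigmaI finite_subset)
  then show ?thesis
    using assms
    by unfold_locales (auto simp: commuting_graph_def arc_to_ends_def symmetric_conv)
qed

text \<open>The infimum over the empty set of paths is \<^term>\<open>\<infinity> :: enat\<close>.\<close>

definition graph_dist :: "('a, 'b) pre_digraph \<Rightarrow> 'a \<Rightarrow> 'a \<Rightarrow> enat" where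
  "graph_dist G u v = (INF p \<in> {p. pre_digraph.apath G u p v}. enat (length p))"

text \<open>Meaningful for finite graphs with at least one vertex, where the maximum exists.\<close>

definition diam :: "('a, 'b) pre_digraph \<Rightarrow> enat" where
  "diam G = Max {graph_dist G u v | u v. u \<in> verts G \<and> v \<in> verts G}"

end

theory Submission
  imports Defs
begin

text \<open>
  Let $P$ be the direct product. Two of its elements commute exactly when they commute in every
  component, so a walk in $\mathcal{G}(P)$ is a family of commuting sequences, one in each factor,
  all of the same length, such that at every moment some component is noncentral. To make
  "the same length" harmless, walks are allowed to pause: a distance is at most $k$ iff the two
  vertices are joined by exactly $k$ lazy steps, each of which moves along an edge or stays put
  (\<open>graph_dist_le_iff\<close>). Every assertion about a diameter is then an assertion about
  the numbers $k$ that bound it, and a finite graph with a vertex is connected iff it has one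
  (\<open>connected_iff_diam_finite\<close>). In particular two diameters are equal as soon as
  they have the same finite bounds, with no separate treatment of $\infty$.

  If some component $j$ is noncentral in every vertex of $P$, then walks in $P$ project to walks in
  $\mathcal{G}(S_j)$, so every bound for $P$ bounds $S_j$. This is the case if $j$ is the only
  noncommutative factor, and also if $S_j$ has empty center. Conversely, such a component keeps the
  elements of $P$ noncentral whatever the others do; so walks of length $k$ in the single factors
  may be put together freely. In a factor with a central element, any two elements are joined
  through that element in two steps, and $k \ge 2$ holds automatically since two noncommuting
  vertices have distance at least 2. Hence the diameter comes from the only
  noncommutative factor, or from the centerless ones
  (\<open>diam_P_le_iff_single\<close>, \<open>diam_P_le_iff_centerless\<close>).

  If all the centers are nonempty, one uses elements that are noncentral in one component only.
  Two of them with different distinguished components commute, which gives walks of length at most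
  3 (\<open>diam_P_le_3\<close>). A walk $x, z, y$ of length 2 has a component $j$ in which $z$ is
  noncentral, and $z_j$ commutes with $x_j$ and $y_j$. So if in each noncommutative factor there
  are two vertices with which no vertex commutes simultaneously, the diameter is 3; and otherwise
  an element that is noncentral only in the right component connects any $x$ and $y$
  (\<open>diam_P_le_2_iff\<close>).
\<close>

section \<open>Distances as numbers of lazy steps\<close>

text \<open>
  Unlike the edges themselves, lazy steps make "joined by $k$ steps" monotone in $k$, so that walks
  of different lengths can be padded to a common length.
\<close>

definition lazy_step :: "('a, 'b) pre_digraph \<Rightarrow> ('a \<times> 'a) set" where
  "lazy_step G = arcs_ends G \<union> Id_on (verts G)"

lemma (in wf_digraph) awalk_imp_lazy_relpow:
  "awalk u p v \<Longrightarrow> (u, v) \<in> lazy_step G ^^ length p"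
proof (induction p arbitrary: u)
  case Nil
  then show ?case by (auto simp: awalk_Nil_iff)
next
  case (Cons e p)
  then have "e \<in> arcs G" "u = tail G e" "awalk (head G e) p v"
    by (auto simp: awalk_Cons_iff)
  then have "(u, head G e) \<in> lazy_step G" "(head G e, v) \<in> lazy_step G ^^ length p"
    using Cons.IH by (auto simp: lazy_step_def arcs_ends_conv)
  then show ?case by (simp only: length_Cons) (rule relpow_Suc_I2)
qed

lemma lazy_relpow_mono:
  assumes "(u, v) \<in> lazy_step G ^^ k" "k \<le> m" "v \<in> verts G"
  shows "(u, v) \<in> lazy_step G ^^ m"
  using assms(2)
proof (induction m rule: dec_induct)
  case base
  then show ?case using assms(1) by simp
next
  case (step m)
  have "(v, v) \<in> lazy_step G" using assms(3) by (simp add: lazy_step_def Id_on_iff)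
  with step.IH show ?case by (rule relpow_Suc_I)
qed

lemma (in wf_digraph) lazy_relpow_imp_awalk:
  "(u, v) \<in> lazy_step G ^^ k \<Longrightarrow> v \<in> verts G \<Longrightarrow> \<exists>p. awalk u p v \<and> length p \<le> k"
proof (induction k arbitrary: u)
  case 0
  then have "awalk u [] v" by (auto simp: awalk_Nil_iff)
  then show ?case by fastforce
next
  case (Suc k)
  from Suc.prems obtain w where w: "(u, w) \<in> lazy_step G" "(w, v) \<in> lazy_step G ^^ k"
    by (meson relpow_Suc_E2)
  from Suc.IH[OF w(2) Suc.prems(2)] obtain p where p: "awalk w p v" "length p \<le> k" by blast
  show ?case
  proof (cases "u = w")
    case True
    with p show ?thesis by (meson le_SucI)
  next
    case False
    with w(1) obtain e where "e \<in> arcs G" "tail G e = u" "head G e = w"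
      by (auto simp: lazy_step_def arcs_ends_conv)
    with p have "awalk u (e # p) v" by (auto simp: awalk_Cons_iff)
    moreover have "length (e # p) \<le> Suc k" using p(2) by simp
    ultimately show ?thesis by blast
  qed
qed

text \<open>
  Cutting cycles out of a walk does not lengthen it; so distances, which are defined by paths, can
  be measured by walks.
\<close>

lemma (in wf_digraph) apath_shorter_than_awalk:
  assumes "awalk u p v"
  shows "\<exists>q. apath u q v \<and> length q \<le> length p"
  using assms
proof (induction rule: awalk_to_apath_induct)
  case (path p)
  then show ?case unfolding apath_def by blast
next
  case (decomp p q r s)
  then have "p = q @ r @ s"
    using awalk_cyc_decomp_has_prop[of u p v] by auto
  with decomp.IH show ?case by fastforce
qed

lemma (in wf_digraph) graph_dist_le_iff:
  assumes "v \<in> verts G"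
  shows "graph_dist G u v \<le> enat k \<longleftrightarrow> (u, v) \<in> lazy_step G ^^ k"
proof
  assume le: "graph_dist G u v \<le> enat k"
  have "{p. apath u p v} \<noteq> {}"
  proof
    assume "{p. apath u p v} = {}"
    then have "graph_dist G u v = \<infinity>" unfolding graph_dist_def by (simp add: top_enat_def)
    with le show False by simp
  qed
  then obtain q where "q \<in> {p. apath u p v}" by blast
  then have "graph_dist G u v \<in> (\<lambda>p. enat (length p)) ` {p. apath u p v}"
    unfolding graph_dist_def
    \<comment> \<open>an infimum of extended naturals over a nonempty set is attained\<close>
    by (rule wellorder_InfI[OF imageI])
  then obtain p where "apath u p v" "length p \<le> k" using le by auto
  then show "(u, v) \<in> lazy_step G ^^ k"
    using lazy_relpow_mono[OF awalk_imp_lazy_relpow[OF awalkI_apath]] assms by simp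
next
  assume "(u, v) \<in> lazy_step G ^^ k"
  then obtain q where "awalk u q v" "length q \<le> k"
    using lazy_relpow_imp_awalk assms by blast
  then obtain p where "apath u p v" "length p \<le> k"
    using apath_shorter_than_awalk le_trans by blast
  then show "graph_dist G u v \<le> enat k"
    unfolding graph_dist_def by (intro INF_lower2[of p]) auto
qed

lemma (in fin_digraph) diam_le_iff:
  assumes "verts G \<noteq> {}"
  shows "diam G \<le> enat k \<longleftrightarrow> (\<forall>u\<in>verts G. \<forall>v\<in>verts G. (u, v) \<in> lazy_step G ^^ k)"
proof -
  have eq: "{graph_dist G u v | u v. u \<in> verts G \<and> v \<in> verts G}
      = (\<lambda>(u, v). graph_dist G u v) ` (verts G \<times> verts G)"
    by auto
  show ?thesis
    using assms graph_dist_le_iff unfolding diam_def eq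
    by (subst Max_le_iff) auto
qed

lemma (in graph) connected_iff_diam_finite:
  assumes "verts G \<noteq> {}"
  shows "connected G \<longleftrightarrow> (\<exists>k. diam G \<le> enat k)"
proof -
  have sym: "(arcs_ends G)\<^sup>s = arcs_ends G"
    using sym_arcs by (auto simp: symcl_def symmetric_def sym_def)
  have conn: "connected G \<longleftrightarrow> (\<forall>u\<in>verts G. \<forall>v\<in>verts G. \<exists>p. apath u p v)"
    using assms unfolding connected_conv sym by (simp add: reachable_def[symmetric] reachable_apath)
  show ?thesis
  proof
    assume "connected G"
    have "\<exists>k. graph_dist G u v \<le> enat k" if uv: "u \<in> verts G" "v \<in> verts G" for u v
    proof -
      obtain p where "apath u p v" using conn \<open>connected G\<close> uv by blast
      then have "graph_dist G u v \<le> enat (length p)"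
        unfolding graph_dist_def by (intro INF_lower) simp
      then show ?thesis by blast
    qed
    then obtain d where d: "graph_dist G u v \<le> enat (d u v)"
      if "u \<in> verts G" "v \<in> verts G" for u v
      by metis
    define D where "D = Max ((\<lambda>(u, v). d u v) ` (verts G \<times> verts G))"
    have "(u, v) \<in> lazy_step G ^^ D" if "u \<in> verts G" "v \<in> verts G" for u v
    proof -
      have "d u v \<le> D" unfolding D_def using that by (intro Max_ge) auto
      moreover have "(u, v) \<in> lazy_step G ^^ d u v"
        using d[OF that] graph_dist_le_iff[OF that(2)] by blast
      ultimately show ?thesis using lazy_relpow_mono[of u v "d u v" G D] that(2) by blast
    qed
    then show "\<exists>k. diam G \<le> enat k" using diam_le_iff[OF assms] by blast
  next
    assume "\<exists>k. diam G \<le> enat k"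
    then obtain k where k: "\<forall>u\<in>verts G. \<forall>v\<in>verts G. (u, v) \<in> lazy_step G ^^ k"
      using diam_le_iff[OF assms] by blast
    have "\<exists>p. apath u p v" if "u \<in> verts G" "v \<in> verts G" for u v
      using lazy_relpow_imp_awalk[of u v k] apath_shorter_than_awalk k that by blast
    then show "connected G" using conn by blast
  qed
qed

lemma enat_eq_if_same_bounds:
  assumes "\<And>k. a \<le> enat k \<longleftrightarrow> b \<le> enat k"
  shows "a = b"
  by (metis assms enat_ord_simps(1) antisym enat_ile linorder_linear not_infinity_eq)

section \<open>Commuting graphs\<close>

definition commuting :: "('a, 'b) monoid_scheme \<Rightarrow> ('a \<times> 'a) set" where
  "commuting T = {(x, y). x \<in> carrier T \<and> y \<in> carrier T \<and> x \<otimes>\<^bsub>T\<^esub> y = y \<otimes>\<^bsub>T\<^esub> x}"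

lemma commuting_sym: "(x, y) \<in> commuting T \<Longrightarrow> (y, x) \<in> commuting T"
  by (auto simp: commuting_def)

lemma verts_commuting_graph [simp]: "verts (commuting_graph T) = carrier T - center T"
  by (simp add: commuting_graph_def)

text \<open>
  The case $x = y$ of a lazy step is absorbed by commutation: every element commutes with itself.
\<close>

lemma lazy_step_commuting_graph:
  "(x, y) \<in> lazy_step (commuting_graph T) \<longleftrightarrow>
     x \<notin> center T \<and> y \<notin> center T \<and> (x, y) \<in> commuting T"
  by (auto simp: lazy_step_def commuting_graph_def commuting_def arcs_ends_conv image_iff)

lemma center_commuting:
  "x \<in> center T \<longleftrightarrow> x \<in> carrier T \<and> (\<forall>y\<in>carrier T. (x, y) \<in> commuting T)"
  by (auto simp: center_def commuting_def)

lemma commutative_iff_center: "commutative T \<longleftrightarrow> center T = carrier T"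
  by (auto simp: commutative_def center_def)

lemma ex_noncentral: "\<not> commutative T \<Longrightarrow> \<exists>x. x \<in> carrier T - center T"
  by (auto simp: commutative_def center_def)

lemma diam_commuting_graph_le_iff:
  assumes "finite (carrier T)" "\<not> commutative T"
  shows "diam (commuting_graph T) \<le> enat k \<longleftrightarrow>
    (\<forall>x \<in> carrier T - center T. \<forall>y \<in> carrier T - center T.
       (x, y) \<in> lazy_step (commuting_graph T) ^^ k)"
proof -
  interpret graph "commuting_graph T" using assms(1) by (rule graph_commuting_graph)
  show ?thesis
    using diam_le_iff assms(2) by (auto simp: commutative_iff_center center_def)
qed

lemma connected_commuting_graph_iff:
  assumes "finite (carrier T)" "\<not> commutative T"
  shows "connected (commuting_graph T) \<longleftrightarrow> (\<exists>k. diam (commuting_graph T) \<le> enat k)"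
proof -
  interpret graph "commuting_graph T" using assms(1) by (rule graph_commuting_graph)
  show ?thesis
    using connected_iff_diam_finite assms(2) by (auto simp: commutative_iff_center center_def)
qed

text \<open>
  Two elements that do not commute are both noncentral, hence vertices at distance at least 2.
\<close>

lemma diam_commuting_graph_ge_2:
  assumes "finite (carrier T)" "\<not> commutative T" "diam (commuting_graph T) \<le> enat k"
  shows "2 \<le> k"
proof (rule ccontr)
  assume "\<not> 2 \<le> k"
  then have "enat k \<le> enat 1" by simp
  with assms(3) have "diam (commuting_graph T) \<le> enat 1" by (rule order_trans)
  then have comm: "(x, y) \<in> commuting T"
    if "x \<in> carrier T - center T" "y \<in> carrier T - center T" for x y
    using that diam_commuting_graph_le_iff[OF assms(1,2)] by (auto simp: lazy_step_commuting_graph)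
  obtain x y where "x \<in> carrier T" "y \<in> carrier T" "(x, y) \<notin> commuting T"
    using assms(2) by (auto simp: commutative_def commuting_def)
  then show False using comm center_commuting commuting_sym by (metis Diff_iff)
qed

lemma diam_commuting_graph_eq_2_iff:
  assumes "finite (carrier T)" "\<not> commutative T"
  shows "diam (commuting_graph T) = 2 \<longleftrightarrow> diam (commuting_graph T) \<le> enat 2"
proof
  assume "diam (commuting_graph T) \<le> enat 2"
  then obtain d where "diam (commuting_graph T) = enat d" "d \<le> 2"
    by (metis enat_ile enat_ord_simps(1))
  with diam_commuting_graph_ge_2[OF assms, of d]
  show "diam (commuting_graph T) = 2" by (simp add: numeral_eq_enat)
qed (simp add: numeral_eq_enat)

text \<open>
  Go to a central element, wait there, and leave in the last step.
\<close>

lemma commuting_relpow_if_center: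
  assumes "center T \<noteq> {}" "2 \<le> k" "x \<in> carrier T" "y \<in> carrier T"
  shows "(x, y) \<in> commuting T ^^ k"
proof -
  from assms(1) obtain z where z: "z \<in> center T" by blast
  have "(x, z) \<in> commuting T ^^ Suc m" for m
  proof (induction m)
    case 0
    have "(x, z) \<in> commuting T" using z assms(3) center_commuting commuting_sym by metis
    then show ?case by simp
  next
    case (Suc m)
    moreover have "(z, z) \<in> commuting T" using z by (auto simp: center_commuting)
    ultimately show ?case by (rule relpow_Suc_I)
  qed
  moreover have "(z, y) \<in> commuting T" using z assms(4) center_commuting by metis
  moreover obtain m where "k = Suc (Suc m)"
    using assms(2) by (metis add_2_eq_Suc le_iff_add)
  ultimately show ?thesis by (metis relpow_Suc_I)
qed

lemma relpow_map:
  assumes "(x, y) \<in> R ^^ k" "\<And>u v. (u, v) \<in> R \<Longrightarrow> (f u, f v) \<in> Q"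
  shows "(f x, f y) \<in> Q ^^ k"
  using assms(1) by (induction k arbitrary: y) (auto intro: assms(2) relpow_Suc_I)

section \<open>Direct products\<close>

locale finite_semigroup_family =
  fixes I :: "'i set" and S :: "'i \<Rightarrow> ('a, 'b) monoid_scheme"
  assumes finite_index: "finite I"
    and semigroup_factor: "i \<in> I \<Longrightarrow> nonempty_semigroup (S i)"
    and finite_factor: "i \<in> I \<Longrightarrow> finite (carrier (S i))"
begin

abbreviation P where "P \<equiv> product_group I S"

definition NC where "NC = {i \<in> I. \<not> commutative (S i)}"

lemma NC_in_index: "i \<in> NC \<Longrightarrow> i \<in> I"
  and NC_noncommutative: "i \<in> NC \<Longrightarrow> \<not> commutative (S i)"
  and NC_finite_factor: "i \<in> NC \<Longrightarrow> finite (carrier (S i))"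
  by (auto simp: NC_def finite_factor)

lemma finite_carrier_P: "finite (carrier P)"
  using finite_index finite_factor by (simp add: finite_PiE)

lemma component_in_carrier: "x \<in> carrier P \<Longrightarrow> i \<in> I \<Longrightarrow> x i \<in> carrier (S i)"
  by (auto simp: PiE_mem)

text \<open>
  A filler for the components that should not matter: central whenever the factor allows it, so
  that it commutes with everything.
\<close>

definition default :: "'i \<Rightarrow> 'a" where
  "default i = (if center (S i) \<noteq> {} then SOME z. z \<in> center (S i) else SOME z. z \<in> carrier (S i))"

lemma default_in_center: "center (S i) \<noteq> {} \<Longrightarrow> default i \<in> center (S i)"
  unfolding default_def by (simp add: some_in_eq)

lemma default_in_carrier: "i \<in> I \<Longrightarrow> default i \<in> carrier (S i)"
  using default_in_center[of i] nonempty_semigroup.nonempty[OF semigroup_factor]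
  by (cases "center (S i) = {}") (auto simp: default_def some_in_eq center_def)

lemma noncentral_in_NC: "i \<in> I \<Longrightarrow> a \<in> carrier (S i) \<Longrightarrow> a \<notin> center (S i) \<Longrightarrow> i \<in> NC"
  by (auto simp: NC_def commutative_iff_center)

lemma center_nonempty_outside_NC: "i \<in> I \<Longrightarrow> i \<notin> NC \<Longrightarrow> center (S i) \<noteq> {}"
  using nonempty_semigroup.nonempty[OF semigroup_factor] by (auto simp: NC_def commutative_iff_center)

lemma commuting_P_iff:
  "(x, y) \<in> commuting P \<longleftrightarrow>
     x \<in> extensional I \<and> y \<in> extensional I \<and> (\<forall>i\<in>I. (x i, y i) \<in> commuting (S i))"
  by (auto simp: commuting_def PiE_iff restrict_def fun_eq_iff)

text \<open>
  To see that a component $x_i$ of a central $x$ commutes with $b$, compare $x$ with the element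
  that differs from $x$ only by having $b$ as its $i$-th component.
\<close>

lemma center_P_iff: "x \<in> center P \<longleftrightarrow> x \<in> extensional I \<and> (\<forall>i\<in>I. x i \<in> center (S i))"
proof
  assume x: "x \<in> center P"
  have "(x i, b) \<in> commuting (S i)" if i: "i \<in> I" and b: "b \<in> carrier (S i)" for i b
  proof -
    from x have "x \<in> carrier P" by (simp add: center_def)
    with i b have "x(i := b) \<in> carrier P" by (auto simp: PiE_iff extensional_def)
    with x have "(x, x(i := b)) \<in> commuting P" by (simp add: center_commuting del: carrier_product_group)
    then show ?thesis using i by (auto simp: commuting_P_iff)
  qed
  with x show "x \<in> extensional I \<and> (\<forall>i\<in>I. x i \<in> center (S i))"
    by (auto simp: center_commuting[of "_ _"] center_def PiE_iff commuting_def)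
next
  assume x: "x \<in> extensional I \<and> (\<forall>i\<in>I. x i \<in> center (S i))"
  then have "x \<in> carrier P" by (auto simp: PiE_iff center_def)
  moreover have "(x, y) \<in> commuting P" if "y \<in> carrier P" for y
    using x that by (auto simp: commuting_P_iff center_commuting PiE_iff)
  ultimately show "x \<in> center P" by (simp add: center_commuting del: carrier_product_group)
qed

lemma noncentral_P_iff:
  "x \<in> carrier P - center P \<longleftrightarrow> x \<in> carrier P \<and> (\<exists>i\<in>NC. x i \<notin> center (S i))"
  using noncentral_in_NC NC_in_index by (fastforce simp: center_P_iff PiE_iff)

lemma noncentralI:
  "x \<in> carrier P \<Longrightarrow> i \<in> NC \<Longrightarrow> x i \<notin> center (S i) \<Longrightarrow> x \<in> carrier P - center P"
  by (subst noncentral_P_iff) blast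

text \<open>
  If all the centers are nonempty, these elements are noncentral at most in the component $j$.
\<close>

definition spike :: "'i \<Rightarrow> 'a \<Rightarrow> 'i \<Rightarrow> 'a" where
  "spike j a = (\<lambda>i\<in>I. if i = j then a else default i)"

lemma spike_in_carrier: "a \<in> carrier (S j) \<Longrightarrow> spike j a \<in> carrier P"
  by (auto simp: spike_def default_in_carrier)

lemma spike_noncentral:
  assumes "j \<in> NC" "a \<in> carrier (S j) - center (S j)"
  shows "spike j a \<in> carrier P - center P"
  using assms by (intro noncentralI[of _ j] spike_in_carrier) (auto simp: spike_def NC_in_index)

lemma noncommutative_P: "NC \<noteq> {} \<Longrightarrow> \<not> commutative P"
proof -
  assume "NC \<noteq> {}"
  then obtain j where j: "j \<in> NC" by blast
  then obtain a where "a \<in> carrier (S j) - center (S j)"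
    using NC_noncommutative ex_noncentral by blast
  with j show ?thesis using spike_noncentral by (auto simp: commutative_iff_center simp del: carrier_product_group)
qed

section \<open>Products with a component that is always noncentral\<close>

text \<open>
  Walks project to the component $j$ because it is noncentral all along the walk, and any two
  vertices of the factor are the projections of vertices of the product.
\<close>

lemma diam_factor_le_diam_P:
  assumes "j \<in> NC" "\<And>x. x \<in> carrier P - center P \<Longrightarrow> x j \<notin> center (S j)"
    and "diam (commuting_graph P) \<le> enat k"
  shows "diam (commuting_graph (S j)) \<le> enat k"
proof -
  have nP: "\<not> commutative P" using assms(1) noncommutative_P by blast
  have "(a, b) \<in> lazy_step (commuting_graph (S j)) ^^ k"
    if a: "a \<in> carrier (S j) - center (S j)" and b: "b \<in> carrier (S j) - center (S j)" for a b
  proof -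
    have "(spike j a, spike j b) \<in> lazy_step (commuting_graph P) ^^ k"
      using assms(3) spike_noncentral[OF assms(1) a] spike_noncentral[OF assms(1) b]
        diam_commuting_graph_le_iff[OF finite_carrier_P nP] by blast
    moreover have "(x j, y j) \<in> lazy_step (commuting_graph (S j))"
      if "(x, y) \<in> lazy_step (commuting_graph P)" for x y
    proof -
      from that have xy: "(x, y) \<in> commuting P" "x \<notin> center P" "y \<notin> center P"
        by (auto simp: lazy_step_commuting_graph)
      moreover from xy(1) have "x \<in> carrier P" "y \<in> carrier P" by (auto simp: commuting_def)
      ultimately show ?thesis
        using assms(1,2) NC_in_index by (auto simp: lazy_step_commuting_graph commuting_P_iff)
    qed
    ultimately have "(spike j a j, spike j b j) \<in> lazy_step (commuting_graph (S j)) ^^ k"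
      by (rule relpow_map[where f = "\<lambda>x. x j"])
    then show ?thesis using assms(1) by (simp add: spike_def NC_in_index)
  qed
  then show ?thesis
    using diam_commuting_graph_le_iff[OF NC_finite_factor NC_noncommutative] assms(1) by blast
qed

text \<open>
  Walks in the factors run in parallel. Only the walk in the component $j$ has to avoid the center,
  which suffices to keep every intermediate element of the product noncentral.
\<close>

lemma lazy_relpow_P_if_factors:
  assumes j: "j \<in> NC" "(x j, y j) \<in> lazy_step (commuting_graph (S j)) ^^ k"
    and x: "x \<in> carrier P" and y: "y \<in> carrier P"
    and fac: "\<And>i. i \<in> I \<Longrightarrow> (x i, y i) \<in> commuting (S i) ^^ k"
  shows "(x, y) \<in> lazy_step (commuting_graph P) ^^ k"
proof -
  obtain g where g: "g 0 = x j" "g k = y j"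
    "\<And>t. t < k \<Longrightarrow> (g t, g (Suc t)) \<in> lazy_step (commuting_graph (S j))"
    using j(2) unfolding relpow_fun_conv by blast
  have "\<forall>i\<in>I. \<exists>h. h 0 = x i \<and> h k = y i \<and> (\<forall>t<k. (h t, h (Suc t)) \<in> commuting (S i))"
    using fac unfolding relpow_fun_conv by blast
  then obtain h where h: "\<And>i. i \<in> I \<Longrightarrow> h i 0 = x i" "\<And>i. i \<in> I \<Longrightarrow> h i k = y i"
    "\<And>i t. i \<in> I \<Longrightarrow> t < k \<Longrightarrow> (h i t, h i (Suc t)) \<in> commuting (S i)"
    by metis
  \<comment> \<open>in the component $j$, the walk inside the commuting graph overrides the other one\<close>
  define F where "F t = (\<lambda>i\<in>I. if i = j then g t else h i t)" for t
  have ends: "F 0 = x" "F k = y"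
    using x y g h by (auto simp: F_def fun_eq_iff PiE_iff extensional_def)
  have "(F t, F (Suc t)) \<in> lazy_step (commuting_graph P)" if "t < k" for t
  proof -
    have "F t j = g t" "F (Suc t) j = g (Suc t)"
      using j(1) NC_in_index by (auto simp: F_def)
    moreover have "g t \<notin> center (S j)" "g (Suc t) \<notin> center (S j)"
      using g(3)[OF that] by (auto simp: lazy_step_commuting_graph)
    ultimately have "F t \<notin> center P" "F (Suc t) \<notin> center P"
      using j(1) NC_in_index center_P_iff by metis+
    moreover have "(F t, F (Suc t)) \<in> commuting P"
      using g(3)[OF that] h(3)[OF _ that]
      by (auto simp: commuting_P_iff F_def lazy_step_commuting_graph)
    ultimately show ?thesis by (simp add: lazy_step_commuting_graph)
  qed
  with ends show ?thesis unfolding relpow_fun_conv by blast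
qed

text \<open>
  Centerless factors are crossed within their diameter, the others through a central element; the
  latter takes 2 steps, which is no more than $k$ because the factor $j$ has diameter at least 2.
\<close>

lemma diam_P_le_if_factors:
  assumes j: "j \<in> NC" "\<And>x. x \<in> carrier P - center P \<Longrightarrow> x j \<notin> center (S j)"
    and diam_j: "diam (commuting_graph (S j)) \<le> enat k"
    and fac: "\<And>i. i \<in> NC \<Longrightarrow> center (S i) = {} \<Longrightarrow> diam (commuting_graph (S i)) \<le> enat k"
  shows "diam (commuting_graph P) \<le> enat k"
proof -
  have nP: "\<not> commutative P" using j(1) noncommutative_P by blast
  have k: "2 \<le> k"
    using diam_commuting_graph_ge_2[OF NC_finite_factor NC_noncommutative] j(1) diam_j by blast
  have lazy: "(a, b) \<in> lazy_step (commuting_graph (S i)) ^^ k"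
    if "i \<in> NC" "diam (commuting_graph (S i)) \<le> enat k"
      "a \<in> carrier (S i) - center (S i)" "b \<in> carrier (S i) - center (S i)" for i a b
    using that diam_commuting_graph_le_iff[OF NC_finite_factor NC_noncommutative] by blast
  have "(x, y) \<in> lazy_step (commuting_graph P) ^^ k"
    if x: "x \<in> carrier P - center P" and y: "y \<in> carrier P - center P" for x y
  proof (rule lazy_relpow_P_if_factors[OF j(1)])
    have x': "x \<in> carrier P" and y': "y \<in> carrier P" using x y by blast+
    show "x \<in> carrier P" "y \<in> carrier P" by (fact x', fact y')
    show "(x j, y j) \<in> lazy_step (commuting_graph (S j)) ^^ k"
      using lazy[OF j(1) diam_j] j(2)[OF x] j(2)[OF y] component_in_carrier x' y' NC_in_index[OF j(1)]
      by blast
    fix i assume i: "i \<in> I"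
    have xi: "x i \<in> carrier (S i)" and yi: "y i \<in> carrier (S i)"
      using component_in_carrier x' y' i by auto
    show "(x i, y i) \<in> commuting (S i) ^^ k"
    proof (cases "center (S i) = {}")
      case True
      then have "i \<in> NC" using center_nonempty_outside_NC i by blast
      then have "(x i, y i) \<in> lazy_step (commuting_graph (S i)) ^^ k"
        using lazy fac True xi yi by blast
      then show ?thesis
        by (rule relpow_map[where f = "\<lambda>x. x"]) (simp add: lazy_step_commuting_graph)
    next
      case False
      then show ?thesis using k xi yi by (rule commuting_relpow_if_center)
    qed
  qed
  then show ?thesis using diam_commuting_graph_le_iff[OF finite_carrier_P nP] by blast
qed

lemma diam_P_le_iff_single:
  assumes "NC = {j}"
  shows "diam (commuting_graph P) \<le> enat k \<longleftrightarrow> diam (commuting_graph (S j)) \<le> enat k"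
proof -
  have j: "j \<in> NC" using assms by simp
  have noncentral_j: "x j \<notin> center (S j)" if "x \<in> carrier P - center P" for x
    using noncentral_P_iff[THEN iffD1, OF that] assms by simp
  show ?thesis
  proof
    assume "diam (commuting_graph P) \<le> enat k"
    then show "diam (commuting_graph (S j)) \<le> enat k"
      using diam_factor_le_diam_P j noncentral_j by blast
  next
    assume "diam (commuting_graph (S j)) \<le> enat k"
    then show "diam (commuting_graph P) \<le> enat k"
      using assms by (intro diam_P_le_if_factors[of j] noncentral_j) auto
  qed
qed

lemma diam_P_le_iff_centerless:
  assumes "j \<in> NC" "center (S j) = {}"
  shows "diam (commuting_graph P) \<le> enat k \<longleftrightarrow>
    (\<forall>i\<in>NC. center (S i) = {} \<longrightarrow> diam (commuting_graph (S i)) \<le> enat k)"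
  using diam_factor_le_diam_P[of _ k] diam_P_le_if_factors[of j k] assms by blast

section \<open>Products of factors with nonempty centers\<close>

lemma commuting_spike:
  assumes cen: "\<And>i. i \<in> I \<Longrightarrow> center (S i) \<noteq> {}"
    and "x \<in> carrier P" "(x j, w) \<in> commuting (S j)"
  shows "(x, spike j w) \<in> commuting P"
proof -
  have "(x i, default i) \<in> commuting (S i)" if "i \<in> I" for i
    using default_in_center[OF cen[OF that]] component_in_carrier[OF assms(2) that]
      center_commuting commuting_sym by metis
  then show ?thesis using assms(2,3) by (auto simp: commuting_P_iff spike_def PiE_iff)
qed

lemma two_steps_via_spike:
  assumes cen: "\<And>i. i \<in> I \<Longrightarrow> center (S i) \<noteq> {}"
    and x: "x \<in> carrier P - center P" and y: "y \<in> carrier P - center P"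
    and j: "j \<in> NC" and w: "w \<notin> center (S j)" "(x j, w) \<in> commuting (S j)" "(y j, w) \<in> commuting (S j)"
  shows "(x, y) \<in> lazy_step (commuting_graph P) ^^ 2"
proof -
  have "w \<in> carrier (S j)" using w(2) by (auto simp: commuting_def)
  then have "spike j w \<notin> center P" using spike_noncentral j w(1) by blast
  moreover have "(x, spike j w) \<in> commuting P"
    using x w(2) by (intro commuting_spike[OF cen]) auto
  moreover have "(spike j w, y) \<in> commuting P"
    using y w(3) by (intro commuting_sym[OF commuting_spike[OF cen]]) auto
  ultimately have "(x, spike j w) \<in> lazy_step (commuting_graph P)"
      "(spike j w, y) \<in> lazy_step (commuting_graph P)"
    using x y by (auto simp: lazy_step_commuting_graph)
  then show ?thesis by (auto simp: numeral_2_eq_2)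
qed

lemma three_steps_via_spikes:
  assumes cen: "\<And>i. i \<in> I \<Longrightarrow> center (S i) \<noteq> {}"
    and x: "x \<in> carrier P" and y: "y \<in> carrier P"
    and ij: "i \<in> NC" "j \<in> NC" "i \<noteq> j" "x i \<notin> center (S i)" "y j \<notin> center (S j)"
  shows "(x, y) \<in> lazy_step (commuting_graph P) ^^ 3"
proof -
  let ?u = "spike i (x i)" and ?v = "spike j (y j)"
  have xi: "x i \<in> carrier (S i)" and yj: "y j \<in> carrier (S j)"
    using component_in_carrier x y ij NC_in_index by simp_all
  have u: "?u \<in> carrier P" and v: "?v \<in> carrier P"
    using xi yj by (simp_all only: spike_in_carrier)
  have nc: "x \<notin> center P" "y \<notin> center P" "?u \<notin> center P" "?v \<notin> center P"
    using noncentralI[OF x ij(1,4)] noncentralI[OF y ij(2,5)]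
      spike_noncentral[OF ij(1)] spike_noncentral[OF ij(2)] ij xi yj by auto
  have "(x, ?u) \<in> commuting P"
    using xi by (intro commuting_spike[OF cen x]) (auto simp: commuting_def)
  moreover have "(?u, ?v) \<in> commuting P"
  proof (rule commuting_spike[OF cen u])
    show "(?u j, y j) \<in> commuting (S j)"
      using default_in_center[OF cen] ij NC_in_index yj center_commuting[of "default j" "S j"]
      by (auto simp: spike_def)
  qed
  moreover have "(?v, y) \<in> commuting P"
    using yj by (intro commuting_sym[OF commuting_spike[OF cen y]]) (auto simp: commuting_def)
  ultimately have "(x, ?u) \<in> lazy_step (commuting_graph P)" "(?u, ?v) \<in> lazy_step (commuting_graph P)"
    "(?v, y) \<in> lazy_step (commuting_graph P)"
    using nc by (auto simp: lazy_step_commuting_graph)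
  then show ?thesis by (auto simp: numeral_3_eq_3)
qed

text \<open>
  If $x$ and $y$ have noncentral components at different places $i$ and $j$, keep only these two
  components. Otherwise all the noncentral components of both are at a single place $i$, and an
  element that is noncentral only at another place commutes with both.
\<close>

lemma diam_P_le_3:
  assumes cen: "\<And>i. i \<in> I \<Longrightarrow> center (S i) \<noteq> {}" and card: "2 \<le> card NC"
  shows "diam (commuting_graph P) \<le> enat 3"
proof -
  have nP: "\<not> commutative P" using card noncommutative_P by fastforce
  have "(x, y) \<in> lazy_step (commuting_graph P) ^^ 3"
    if x: "x \<in> carrier P - center P" and y: "y \<in> carrier P - center P" for x y
  proof (cases "\<exists>i\<in>NC. \<exists>j\<in>NC. i \<noteq> j \<and> x i \<notin> center (S i) \<and> y j \<notin> center (S j)")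
    case True
    then show ?thesis using three_steps_via_spikes[OF cen] x y by blast
  next
    case False
    then have none: "i = j" if "i \<in> NC" "j \<in> NC" "x i \<notin> center (S i)" "y j \<notin> center (S j)" for i j
      using that by metis
    obtain i where i: "i \<in> NC" "x i \<notin> center (S i)" using x noncentral_P_iff by blast
    obtain l where l: "l \<in> NC" "y l \<notin> center (S l)" using y noncentral_P_iff by blast
    have "\<not> NC \<subseteq> {i}"
      using card card_mono[of "{i}" NC] by auto
    then obtain j where j: "j \<in> NC" "j \<noteq> i" by blast
    have "l = i" using none[OF i(1) l(1) i(2) l(2)] by simp
    then have xj: "x j \<in> center (S j)" and yj: "y j \<in> center (S j)"
      using none[OF j(1) l(1) _ l(2)] none[OF i(1) j(1) i(2)] j(2) by metis+
    obtain w where w: "w \<in> carrier (S j)" "w \<notin> center (S j)"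
      using ex_noncentral[OF NC_noncommutative[OF j(1)]] by blast
    have "(x, y) \<in> lazy_step (commuting_graph P) ^^ 2"
    proof (rule two_steps_via_spike[OF cen x y j(1) w(2)])
      show "(x j, w) \<in> commuting (S j)" "(y j, w) \<in> commuting (S j)"
        using xj yj w(1) center_commuting by metis+
    qed
    then show ?thesis by (rule lazy_relpow_mono) (use y in auto)
  qed
  then show ?thesis using diam_commuting_graph_le_iff[OF finite_carrier_P nP] by blast
qed

text \<open>
  Central elements $a$ and $b$ are included: a central one imposes no condition, and a noncentral
  one commutes with itself.
\<close>

lemma ex_noncentral_commuting_with_both:
  assumes j: "j \<in> NC" and diam_j: "diam (commuting_graph (S j)) \<le> enat 2"
    and ab: "a \<in> carrier (S j)" "b \<in> carrier (S j)"
  shows "\<exists>w. w \<notin> center (S j) \<and> (a, w) \<in> commuting (S j) \<and> (b, w) \<in> commuting (S j)"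
proof -
  have refl: "(c, c) \<in> commuting (S j)" if "c \<in> carrier (S j)" for c
    using that by (simp add: commuting_def)
  obtain c where c: "c \<in> carrier (S j)" "c \<notin> center (S j)"
    using ex_noncentral[OF NC_noncommutative[OF j]] by blast
  show ?thesis
  proof (cases "a \<in> center (S j)"; cases "b \<in> center (S j)")
    assume "a \<notin> center (S j)" "b \<notin> center (S j)"
    then have "(a, b) \<in> lazy_step (commuting_graph (S j)) ^^ 2"
      using diam_j ab diam_commuting_graph_le_iff[OF NC_finite_factor NC_noncommutative] j by blast
    then show ?thesis
      using commuting_sym by (fastforce simp: numeral_2_eq_2 lazy_step_commuting_graph)
  qed (use c ab refl center_commuting[of _ "S j"] in blast)+
qed

text \<open>
  For the forward direction, choose in each noncommutative factor two vertices at distance more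
  than 2. No vertex $z$ commutes with both of the resulting tuples, since it would be noncentral
  in some factor and would connect the two chosen vertices there.
\<close>

lemma diam_P_le_2_iff:
  assumes cen: "\<And>i. i \<in> I \<Longrightarrow> center (S i) \<noteq> {}" and ne: "NC \<noteq> {}"
  shows "diam (commuting_graph P) \<le> enat 2 \<longleftrightarrow>
    (\<exists>j\<in>NC. diam (commuting_graph (S j)) \<le> enat 2)"
proof
  assume "\<exists>j\<in>NC. diam (commuting_graph (S j)) \<le> enat 2"
  then obtain j where j: "j \<in> NC" "diam (commuting_graph (S j)) \<le> enat 2" by blast
  have "(x, y) \<in> lazy_step (commuting_graph P) ^^ 2"
    if x: "x \<in> carrier P - center P" and y: "y \<in> carrier P - center P" for x y
  proof -
    have "x j \<in> carrier (S j)" "y j \<in> carrier (S j)"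
      using x y j(1) NC_in_index component_in_carrier by blast+
    from ex_noncentral_commuting_with_both[OF j this] show ?thesis
      using two_steps_via_spike[OF cen x y j(1)] by blast
  qed
  then show "diam (commuting_graph P) \<le> enat 2"
    using diam_commuting_graph_le_iff[OF finite_carrier_P noncommutative_P[OF ne]] by blast
next
  assume diam_P: "diam (commuting_graph P) \<le> enat 2"
  show "\<exists>j\<in>NC. diam (commuting_graph (S j)) \<le> enat 2"
  proof (rule ccontr)
    assume "\<not> ?thesis"
    then have "\<forall>j\<in>NC. \<exists>a b. a \<in> carrier (S j) - center (S j) \<and> b \<in> carrier (S j) - center (S j)
        \<and> (a, b) \<notin> lazy_step (commuting_graph (S j)) ^^ 2"
      using diam_commuting_graph_le_iff[OF NC_finite_factor NC_noncommutative] by blast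
    then obtain a b where ab: "a j \<in> carrier (S j) - center (S j)" "b j \<in> carrier (S j) - center (S j)"
        "(a j, b j) \<notin> lazy_step (commuting_graph (S j)) ^^ 2" if "j \<in> NC" for j
      by metis
    define x where "x = (\<lambda>i\<in>I. if i \<in> NC then a i else default i)"
    define y where "y = (\<lambda>i\<in>I. if i \<in> NC then b i else default i)"
    have xy: "x j = a j" "y j = b j" if "j \<in> NC" for j
      using that NC_in_index by (auto simp: x_def y_def)
    have "x \<in> carrier P" "y \<in> carrier P"
      using ab default_in_carrier by (auto simp: x_def y_def)
    then have "x \<in> carrier P - center P" "y \<in> carrier P - center P"
      using ne ab xy noncentralI by (metis DiffE ex_in_conv)+
    then have "(x, y) \<in> lazy_step (commuting_graph P) ^^ 2"
      using diam_P diam_commuting_graph_le_iff[OF finite_carrier_P noncommutative_P[OF ne]] by blast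
    then obtain z where z: "(x, z) \<in> lazy_step (commuting_graph P)" "(z, y) \<in> lazy_step (commuting_graph P)"
      by (auto simp: numeral_2_eq_2)
    then have "z \<in> carrier P - center P" by (auto simp: lazy_step_commuting_graph commuting_def)
    then obtain j where j: "j \<in> NC" "z j \<notin> center (S j)" using noncentral_P_iff by blast
    have "(a j, z j) \<in> commuting (S j)" "(z j, b j) \<in> commuting (S j)"
      using z NC_in_index[OF j(1)] xy[OF j(1)]
      by (force simp: lazy_step_commuting_graph commuting_P_iff)+
    then have "(a j, z j) \<in> lazy_step (commuting_graph (S j))" "(z j, b j) \<in> lazy_step (commuting_graph (S j))"
      using j ab(1,2)[OF j(1)] by (auto simp: lazy_step_commuting_graph)
    then have "(a j, b j) \<in> lazy_step (commuting_graph (S j)) ^^ 2" by (auto simp: numeral_2_eq_2)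
    with ab(3)[OF j(1)] show False by blast
  qed
qed

section \<open>Connectedness and diameter of the product\<close>

lemma finite_NC: "finite NC"
  using finite_index by (simp add: NC_def)

lemma connected_factor_iff:
  "i \<in> NC \<Longrightarrow> connected (commuting_graph (S i)) \<longleftrightarrow> (\<exists>k. diam (commuting_graph (S i)) \<le> enat k)"
  using connected_commuting_graph_iff NC_finite_factor NC_noncommutative by blast

text \<open>
  If some factor is centerless, the bounds for the product are the common bounds of the centerless
  factors, and these exist iff each of the finitely many factors has one.
\<close>

lemma connected_P_iff:
  assumes "2 \<le> card NC"
  shows "connected (commuting_graph P) \<longleftrightarrow>
    (\<forall>i\<in>NC. center (S i) \<noteq> {} \<or> connected (commuting_graph (S i)))"
proof -
  have ne: "NC \<noteq> {}" using assms by auto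
  note conn_P = connected_commuting_graph_iff[OF finite_carrier_P noncommutative_P[OF ne]]
  show ?thesis
  proof (cases "\<forall>i\<in>NC. center (S i) \<noteq> {}")
    case True
    then show ?thesis
      using diam_P_le_3 assms center_nonempty_outside_NC conn_P by blast
  next
    case False
    then obtain j where j: "j \<in> NC" "center (S j) = {}" by blast
    let ?J = "{i \<in> NC. center (S i) = {}}"
    have "(\<exists>k. \<forall>i\<in>?J. diam (commuting_graph (S i)) \<le> enat k)
        \<longleftrightarrow> (\<forall>i\<in>?J. \<exists>k. diam (commuting_graph (S i)) \<le> enat k)"
    proof
      assume "\<forall>i\<in>?J. \<exists>k. diam (commuting_graph (S i)) \<le> enat k"
      then obtain d where d: "\<And>i. i \<in> ?J \<Longrightarrow> diam (commuting_graph (S i)) \<le> enat (d i)" by metis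
      have "enat (d i) \<le> enat (Max (d ` ?J))" if "i \<in> ?J" for i
        using that finite_NC by auto
      then show "\<exists>k. \<forall>i\<in>?J. diam (commuting_graph (S i)) \<le> enat k" using d by (meson order_trans)
    qed blast
    then show ?thesis
      using conn_P diam_P_le_iff_centerless[OF j] connected_factor_iff by auto
  qed
qed

lemma diam_P_centerless:
  assumes "j \<in> NC" "center (S j) = {}"
  shows "diam (commuting_graph P) = Max {diam (commuting_graph (S i)) | i. i \<in> NC \<and> center (S i) = {}}"
proof (rule enat_eq_if_same_bounds)
  fix k
  have "finite {diam (commuting_graph (S i)) | i. i \<in> NC \<and> center (S i) = {}}"
    using finite_NC by simp
  moreover have "{diam (commuting_graph (S i)) | i. i \<in> NC \<and> center (S i) = {}} \<noteq> {}"
    using assms by blast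
  ultimately show "diam (commuting_graph P) \<le> enat k \<longleftrightarrow>
      Max {diam (commuting_graph (S i)) | i. i \<in> NC \<and> center (S i) = {}} \<le> enat k"
    using diam_P_le_iff_centerless[OF assms] by (subst Max_le_iff) auto
qed

lemma diam_P_central:
  assumes cen: "\<forall>i\<in>NC. center (S i) \<noteq> {}" and card: "2 \<le> card NC"
  shows "diam (commuting_graph P) \<in> {2, 3}"
    and "diam (commuting_graph P) = 2 \<longleftrightarrow> (\<exists>j\<in>NC. diam (commuting_graph (S j)) = 2)"
proof -
  have ne: "NC \<noteq> {}" using card by auto
  have cen': "center (S i) \<noteq> {}" if "i \<in> I" for i
    using cen center_nonempty_outside_NC that by blast
  obtain d where d: "diam (commuting_graph P) = enat d" "d \<le> 3"
    using diam_P_le_3[OF cen' card] by (metis enat_ile enat_ord_simps(1))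
  moreover have "2 \<le> d"
    using diam_commuting_graph_ge_2[OF finite_carrier_P noncommutative_P[OF ne], of d] d by simp
  ultimately show "diam (commuting_graph P) \<in> {2, 3}"
    by (auto simp: numeral_eq_enat)
  have "diam (commuting_graph P) = 2 \<longleftrightarrow> (\<exists>j\<in>NC. diam (commuting_graph (S j)) \<le> enat 2)"
    using diam_P_le_2_iff[OF cen' ne]
      diam_commuting_graph_eq_2_iff[OF finite_carrier_P noncommutative_P[OF ne]] by blast
  then show "diam (commuting_graph P) = 2 \<longleftrightarrow> (\<exists>j\<in>NC. diam (commuting_graph (S j)) = 2)"
    using diam_commuting_graph_eq_2_iff[OF NC_finite_factor NC_noncommutative] by blast
qed

end

theorem theorem4p4:
  fixes n :: nat
    and S :: "nat \<Rightarrow> ('a, 'b) monoid_scheme"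
  defines "P \<equiv> product_group {1..n} S"
    and "NC \<equiv> {i \<in> {1..n}. \<not> commutative (S i)}"
  assumes "\<And>i. i \<in> {1..n} \<Longrightarrow> nonempty_semigroup (S i)"
    and "\<And>i. i \<in> {1..n} \<Longrightarrow> finite (carrier (S i))"
    and "NC \<noteq> {}"
  shows
    "(\<forall>i. NC = {i} \<longrightarrow>
        (connected (commuting_graph P) \<longleftrightarrow> connected (commuting_graph (S i))) \<and>
        (connected (commuting_graph P) \<longrightarrow>
          diam (commuting_graph P) = diam (commuting_graph (S i)))) \<and>
     (card NC \<ge> 2 \<longrightarrow>
        (connected (commuting_graph P) \<longleftrightarrow>
          (\<forall>i\<in>NC. center (S i) \<noteq> {} \<or> connected (commuting_graph (S i)))) \<and>
        (connected (commuting_graph P) \<longrightarrow>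
          ((\<forall>i\<in>NC. center (S i) \<noteq> {}) \<longrightarrow>
            diam (commuting_graph P) \<in> {2, 3} \<and>
            (diam (commuting_graph P) = 2 \<longleftrightarrow> (\<exists>j\<in>NC. diam (commuting_graph (S j)) = 2))) \<and>
          ((\<exists>j\<in>NC. center (S j) = {}) \<longrightarrow>
            diam (commuting_graph P) =
              Max {diam (commuting_graph (S i)) | i. i \<in> NC \<and> center (S i) = {}})))"
proof -
  interpret family: finite_semigroup_family "{1..n}" S
    using assms(3,4) by (intro finite_semigroup_family.intro) auto
  have NC: "NC = family.NC" unfolding NC_def family.NC_def ..
  note P = P_def[symmetric] NC[symmetric]
  have nP: "\<not> commutative P"
    using family.noncommutative_P assms(5) unfolding P by blast
  have fP: "finite (carrier P)"
    using family.finite_carrier_P unfolding P .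
  have single: "diam (commuting_graph P) \<le> enat k \<longleftrightarrow> diam (commuting_graph (S i)) \<le> enat k"
    if "NC = {i}" for i k
    using family.diam_P_le_iff_single that unfolding P by blast
  have conn: "connected (commuting_graph P) \<longleftrightarrow> connected (commuting_graph (S i))"
    if "NC = {i}" for i
    using connected_commuting_graph_iff[OF fP nP] family.connected_factor_iff[of i] single that
    unfolding P by auto
  show ?thesis
    using conn enat_eq_if_same_bounds[OF single] family.connected_P_iff
      family.diam_P_central family.diam_P_centerless
    unfolding P by (intro conjI allI impI) blast+
qed

end
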